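(* Let $R$ be an integral domain with quotient field $K$ that has at least one atom, and suppose that every nonconstant irreducible polynomial $f \in R[x]$ is irreducible in $K[x]$. Then $\rho(R) = \rho(R[x]) = 1$.
   Context: For an integral domain $D$, an atom is an irreducible element (a nonzero nonunit that is not a product of two nonunits). $\mathrm{A}(D)$ denotes the set of elements of $D$ that can be expressed as a product of atoms. For a nonzero nonunit $a \in \mathrm{A}(D)$, the elasticity of $a$ is $\rho(a) = \sup\{ n/m : a = \pi_1\cdots\pi_n = \xi_1\cdots\xi_m \text{ with all } \pi_i, \xi_j \text{ irreducible in } D\}$. The elasticity of $D$ is $\rho(D) = \sup\{\rho(a) : a \in \mathrm{A}(D)\text{ a nonzero nonunit}\} \in [1,\infty]$; it is undefined if $D$ has no atoms. $D$ is not assumed to be atomic. *)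

theory Defs
  imports "HOL-Computational_Algebra.Computational_Algebra" "HOL-Library.Extended_Real"
begin

text \<open>
  Atoms are the elements satisfying \<^const>\<open>irreducible\<close>. The empty product is allowed below;
  it only contributes the unit 1, and every elasticity is taken at nonunits.
\<close>

definition atom_factorization :: "'a::idom list \<Rightarrow> 'a \<Rightarrow> bool" where
  "atom_factorization ps a \<longleftrightarrow> (\<forall>p\<in>set ps. irreducible p) \<and> a = prod_list ps"

definition atom_products :: "'a::idom set" where
  "atom_products = {a. \<exists>ps. atom_factorization ps a}"

definition element_elasticity :: "'a::idom \<Rightarrow> ereal" where
  "element_elasticity a =
     Sup {ereal (real (length ps) / real (length qs)) | ps qs.
            atom_factorization ps a \<and> atom_factorization qs a}"

text \<open>
  In a domain without atoms, where the elasticity is undefined, this is the supremum of the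
  empty set, i.e. \<open>-\<infinity>\<close>, which is not the elasticity of any domain that has atoms.
\<close>

definition elasticity :: "'a::idom itself \<Rightarrow> ereal" where
  "elasticity _ =
     (SUP a \<in> {a \<in> atom_products :: 'a set. a \<noteq> 0 \<and> \<not> a dvd 1}. element_elasticity a)"

end

theory Submission
  imports Defs
begin

text \<open>
  If an atom \<open>p\<close> divides \<open>a b\<close> but neither factor, then \<open>(p x + a) (p x + b) / p\<close> splits over the
  quotient field, so it is reducible over \<open>R\<close>. A factorization into linear factors would make
  \<open>- a / p\<close> or \<open>- b / p\<close> a root in \<open>R\<close>, so a constant is split off, which can only be \<open>p\<close>. Then
  \<open>(x + a / p) (x + b / p)\<close> lies in \<open>R[x]\<close> and is monic, and the same argument is contradictory.
  Hence atoms of \<open>R\<close> are prime, and they stay prime in \<open>R[x]\<close>. In a product of atoms of \<open>R[x]\<close>, the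
  number of constant atoms is therefore determined by primality, and the number of nonconstant
  ones by unique factorization in \<open>K[x]\<close>, where constants are units.
\<close>

section \<open>Counting prime factors in products of atoms\<close>

text \<open>A prime dividing the product of \<open>qs\<close> divides some atom \<open>q\<close> of
  the list, and the cofactor is then a unit; cancelling this pair allows induction on
  \<open>ps\<close>. The filter keeps track of which atoms get matched, which later confines the
  count to constant polynomials.\<close>

lemma length_primes_le_if_prod_list_dvd:
  fixes ps qs :: "'a::idom list"
  assumes "\<forall>p\<in>set ps. prime_elem p" "\<forall>q\<in>set qs. irreducible q" "prod_list ps dvd prod_list qs"
  shows "length ps \<le> length (filter (\<lambda>q. \<exists>p\<in>set ps. p dvd q) qs)"
  using assms
proof (induction ps arbitrary: qs)
  case Nil
  then show ?case by simp
next
  case (Cons p ps)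
  have p: "prime_elem p" using Cons.prems by simp
  have "p dvd prod_list qs" using Cons.prems(3) by (auto dest: dvd_mult_left)
  then have "\<exists>q\<in>set qs. p dvd q"
  proof (induction qs)
    case Nil
    then show ?case using p by (auto simp: prime_elem_def)
  next
    case (Cons a qs)
    then show ?case using p by (auto simp: prime_elem_dvd_mult_iff)
  qed
  then obtain q where q: "q \<in> set qs" "p dvd q" by blast
  then obtain v where v: "q = p * v" by (auto elim: dvdE)
  have v_unit: "v dvd 1"
    using Cons.prems(2) q v irreducibleD[of q p v] p by (auto simp: prime_elem_def)
  obtain xs ys where qs: "qs = xs @ q # ys" using q(1) by (meson split_list)
  have "p * prod_list ps dvd p * (v * prod_list (xs @ ys))"
    using Cons.prems(3) unfolding qs v by (simp add: mult_ac)
  then have "prod_list ps dvd v * prod_list (xs @ ys)"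
    using p by (auto simp: prime_elem_def)
  then have "prod_list ps dvd prod_list (xs @ ys)"
    using mult_dvd_mono[OF v_unit dvd_refl[of "prod_list (xs @ ys)"]]
    by (metis dvd_trans mult_1_left)
  then have "length ps \<le> length (filter (\<lambda>q. \<exists>p\<in>set ps. p dvd q) (xs @ ys))"
    using Cons.prems qs by (intro Cons.IH) auto
  also have "\<dots> \<le> length (filter (\<lambda>q. \<exists>p\<in>set (p # ps). p dvd q) (xs @ ys))"
  proof -
    have *: "length (filter P zs) \<le> length (filter Q zs)" if "\<And>z. P z \<Longrightarrow> Q z"
      for P Q and zs :: "'a list"
      using that by (induction zs) (auto simp: le_SucI)
    show ?thesis by (rule *) auto
  qed
  finally show ?case using q by (simp add: qs)
qed

lemma length_eq_if_irreducible_imp_prime: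
  fixes ps qs :: "'a::idom list"
  assumes irreducible_imp_prime: "\<And>p::'a. irreducible p \<Longrightarrow> prime_elem p"
    and ps_qs: "\<forall>p\<in>set ps. irreducible p" "\<forall>q\<in>set qs. irreducible q" "prod_list ps = prod_list qs"
  shows "length ps = length qs"
proof (rule antisym)
  have *: "length ps \<le> length qs"
    if "\<forall>p\<in>set ps. irreducible p" "\<forall>q\<in>set qs. irreducible q" "prod_list ps = prod_list qs"
    for ps qs :: "'a list"
  proof -
    have "length ps \<le> length (filter (\<lambda>q. \<exists>p\<in>set ps. p dvd q) qs)"
      using that irreducible_imp_prime by (intro length_primes_le_if_prod_list_dvd) auto
    then show ?thesis using length_filter_le le_trans by blast
  qed
  show "length ps \<le> length qs" "length qs \<le> length ps" using ps_qs by (simp_all add: *)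
qed

section \<open>Elasticity when factorization lengths are unique\<close>

lemma elasticity_eq_1_if_half_factorial:
  assumes ex: "\<exists>p::'a::idom. irreducible p"
    and half_factorial: "\<And>ps qs :: 'a list. \<forall>p\<in>set ps. irreducible p \<Longrightarrow> \<forall>q\<in>set qs. irreducible q \<Longrightarrow>
      prod_list ps = prod_list qs \<Longrightarrow> length ps = length qs"
  shows "elasticity TYPE('a) = 1"
proof -
  have "element_elasticity a = 1" if a: "a \<in> atom_products" "\<not> a dvd 1" for a :: 'a
  proof -
    obtain as where as: "atom_factorization as a" using a(1) by (auto simp: atom_products_def)
    have ratio: "real (length ps) / real (length qs) = 1"
      if "atom_factorization ps a" "atom_factorization qs a" for ps qs
    proof -
      \<comment> \<open>Since \<open>a\<close> is a nonunit, \<open>qs\<close> is not empty. This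
        rules out the default value \<open>0 / 0 = 0\<close> of the ratio.\<close>
      have "length ps = length qs" "length qs \<noteq> 0"
        using that a(2) by (auto simp: atom_factorization_def intro!: half_factorial)
      then show ?thesis by simp
    qed
    have "element_elasticity a \<le> 1"
      unfolding element_elasticity_def by (rule Sup_least) (use ratio in \<open>force simp only: one_ereal_def\<close>)
    moreover have "ereal (real (length as) / real (length as)) \<le> element_elasticity a"
      unfolding element_elasticity_def using as by (intro Sup_upper) blast
    ultimately show ?thesis unfolding ratio[OF as as] by (simp add: one_ereal_def)
  qed
  moreover obtain p :: 'a where p: "irreducible p" using ex by blast
  have "atom_factorization [p] p" using p by (simp add: atom_factorization_def)
  then have "p \<in> {a \<in> atom_products. a \<noteq> 0 \<and> \<not> a dvd 1}"
    using p irreducible_not_unit by (auto simp: atom_products_def)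
  ultimately show ?thesis
    unfolding elasticity_def by (intro antisym SUP_least SUP_upper2[of p]) auto
qed

section \<open>Primality of the atoms of the coefficient ring\<close>

text \<open>A linear factor whose leading coefficient is a unit has its root in the ring. The root
  is written as \<open>- d\<close>, so that the roots \<open>- a / p\<close> and
  \<open>- b / p\<close> considered below correspond to \<open>d = a / p\<close> and
  \<open>d = b / p\<close>.\<close>

lemma linear_factor_root:
  fixes g h :: "'a::idom poly"
  assumes gh: "g * h = [:c, s, l:]" and deg: "degree g = 1" and unit: "coeff g 1 dvd 1"
  shows "\<exists>d. l * d\<^sup>2 - s * d + c = 0"
proof -
  obtain v where v: "coeff g 1 * v = 1" using unit by (metis dvdE)
  have "poly g (- (v * coeff g 0)) = coeff g 0 - (coeff g 1 * v) * coeff g 0"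
    by (simp add: poly_altdef deg)
  then have "poly g (- (v * coeff g 0)) = 0" using v by simp
  then have "poly [:c, s, l:] (- (v * coeff g 0)) = 0"
    unfolding gh[symmetric] by simp
  then show ?thesis by (intro exI[of _ "v * coeff g 0"]) (simp add: algebra_simps power2_eq_square)
qed

context
  assumes irreducible_over_fract: "\<And>f :: 'a::idom poly. degree f > 0 \<Longrightarrow> irreducible f \<Longrightarrow>
    irreducible (map_poly to_fract f :: 'a fract poly)"
begin

text \<open>The quadratic in question is \<open>l (x + a / p) (x + b / p)\<close>.\<close>

lemma split_quadratic_common_divisor:
  fixes a b c l p s :: 'a
  assumes l: "l dvd 1 \<or> irreducible l" and l0: "l \<noteq> 0" and p0: "p \<noteq> 0"
    and ab: "l * (a * b) = p\<^sup>2 * c" and sum: "l * (a + b) = p * s"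
    and na: "\<not> p dvd a" and nb: "\<not> p dvd b"
  shows "\<exists>d. \<not> d dvd 1 \<and> d dvd l \<and> d dvd s \<and> d dvd c"
proof -
  define f where "f = [:c, s, l:]"
  have deg_f: "degree f = 2" using l0 by (simp add: f_def)
  have f0: "f \<noteq> 0" using l0 by (simp add: f_def)
  have f_unit: "\<not> f dvd 1" using deg_f by (auto simp: is_unit_poly_iff)
  have no_root: "l * d\<^sup>2 - s * d + c \<noteq> 0" for d
  proof
    assume root: "l * d\<^sup>2 - s * d + c = 0"
    \<comment> \<open>This product is \<open>p\<^sup>2\<close> times the value of \<open>f\<close>
      at \<open>- d\<close>, so a root makes one of its two linear factors vanish, against
      \<open>na\<close> and \<open>nb\<close>.\<close>
    have "l * ((p * d - a) * (p * d - b)) = p\<^sup>2 * (l * d\<^sup>2) - p * d * (l * (a + b)) + l * (a * b)"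
      by (simp add: algebra_simps power2_eq_square)
    also have "\<dots> = p\<^sup>2 * (l * d\<^sup>2 - s * d + c)"
      unfolding ab sum by (simp add: algebra_simps power2_eq_square)
    finally have "p * d = a \<or> p * d = b" using root l0 by simp
    then show False using na nb by auto
  qed
  have "\<not> irreducible f"
  proof
    assume "irreducible f"
    then have irr: "irreducible (map_poly to_fract f)"
      using irreducible_over_fract deg_f by simp
    define A B P L where "A = to_fract a" "B = to_fract b" "P = to_fract p" "L = to_fract l"
    have P0: "P \<noteq> 0" using p0 by (simp add: A_B_P_L_def)
    have L0: "L \<noteq> 0" using l0 by (simp add: A_B_P_L_def)
    have ab': "L * (A * B) = P\<^sup>2 * to_fract c"
      using arg_cong[OF ab, of to_fract] by (simp add: A_B_P_L_def power2_eq_square)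
    have sum': "L * (A + B) = P * to_fract s"
      using arg_cong[OF sum, of to_fract] by (simp add: A_B_P_L_def)
    have "map_poly to_fract f = [:to_fract c, to_fract s, L:]"
      by (simp add: f_def A_B_P_L_def map_poly_pCons)
    \<comment> \<open>Over the quotient field the roots are \<open>- A / P\<close> and
      \<open>- B / P\<close>. Both factors have degree 1, hence are nonunits.\<close>
    also have "\<dots> = [:L * A / P, L:] * [:B / P, 1:]"
      using P0 ab' sum' by (simp add: field_simps power2_eq_square)
    finally have "[:L * A / P, L:] dvd 1 \<or> [:B / P, 1:] dvd 1"
      using irreducibleD[OF irr] by blast
    then show False using L0 by (auto simp: is_unit_poly_iff)
  qed
  then obtain g h where gh: "f = g * h" and g: "\<not> g dvd 1" and h: "\<not> h dvd 1"
    using f0 f_unit unfolding irreducible_def by blast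
  \<comment> \<open>A constant factor of \<open>f\<close> divides all three coefficients, so a
    nonunit one is the required common divisor.\<close>
  have const: ?thesis if const: "f = u * w" "degree u = 0" "\<not> u dvd 1" for u w
  proof -
    obtain d where d: "u = [:d:]" using const(2) by (rule degree_eq_zeroE)
    have "d dvd coeff f n" for n using const(1) by (simp add: d)
    from this[of 0] this[of 1] this[of 2] have "d dvd c \<and> d dvd s \<and> d dvd l"
      by (simp add: f_def eval_nat_numeral)
    moreover have "\<not> d dvd 1" using const(3) d by (simp add: is_unit_const_poly_iff)
    ultimately show ?thesis by blast
  qed
  have "degree g + degree h = 2"
    using f0 deg_f unfolding gh by (subst degree_mult_eq[symmetric]) auto
  then consider "degree g = 0" | "degree h = 0" | "degree g = 1" "degree h = 1" by linarith
  then show ?thesis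
  proof cases
    case 1
    then show ?thesis using const gh g by blast
  next
    case 2
    then show ?thesis using const[of h g] gh h by (simp add: mult.commute)
  next
    case 3
    have "coeff g 1 * coeff h 1 = lead_coeff f"
      using 3 gh by (simp add: lead_coeff_mult)
    then have "coeff g 1 * coeff h 1 = l" using l0 by (simp add: f_def)
    \<comment> \<open>As \<open>l\<close> is a unit or an atom, one of the two leading coefficients
      is a unit. Its linear factor then yields a root in the ring, which \<open>no_root\<close>
      excludes.\<close>
    then have "coeff g 1 dvd 1 \<or> coeff h 1 dvd 1"
      using l by (metis dvd_mult_left irreducibleD)
    moreover have "g * h = [:c, s, l:]" "h * g = [:c, s, l:]"
      using gh by (simp_all add: f_def mult.commute[of h])
    ultimately have "\<exists>d. l * d\<^sup>2 - s * d + c = 0"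
      using linear_factor_root 3 by blast
    then show ?thesis using no_root by blast
  qed
qed

lemma irreducible_imp_prime_elem_coeff:
  fixes p :: 'a
  assumes p: "irreducible p"
  shows "prime_elem p"
proof (rule prime_elemI)
  show p0: "p \<noteq> 0" and pu: "\<not> p dvd 1" using p by (auto simp: irreducible_def)
  fix a b assume "p dvd a * b"
  then obtain c where c: "a * b = p * c" by (auto elim: dvdE)
  show "p dvd a \<or> p dvd b"
  proof (rule ccontr)
    assume "\<not> (p dvd a \<or> p dvd b)"
    then have n: "\<not> p dvd a" "\<not> p dvd b" by auto
    \<comment> \<open>Here \<open>l = p\<close>: the quadratic is
      \<open>(p x + a) (p x + b) / p\<close>, with coefficients \<open>p\<close>,
      \<open>a + b\<close> and \<open>c\<close>. The nonunit \<open>d\<close> divides the atom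
      \<open>p\<close>, so it is an associate of \<open>p\<close>.\<close>
    obtain d where d: "\<not> d dvd 1" "d dvd p" "d dvd a + b" "d dvd c"
      using split_quadratic_common_divisor[of p p a b c "a + b"] p p0 c n
      by (auto simp: power2_eq_square mult.assoc)
    obtain u where u: "p = d * u" using d(2) by (rule dvdE)
    then have "u dvd 1" using irreducibleD[OF p u] d(1) by blast
    then obtain w where "1 = u * w" by (rule dvdE)
    then have "d = p * w" by (simp add: u mult.assoc)
    then have "p dvd d" by (rule dvdI)
    \<comment> \<open>Now \<open>(x + a / p) (x + b / p)\<close> has coefficients \<open>1\<close>,
      \<open>s\<close> and \<open>e\<close> in the ring. With \<open>l = 1\<close> a common divisor
      would be a nonunit dividing 1.\<close>
    then obtain e s where "c = p * e" "a + b = p * s"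
      using d by (meson dvdE dvd_trans)
    then show False
      using split_quadratic_common_divisor[of 1 p a b e s] p0 c n
      by (auto simp: power2_eq_square mult.assoc)
  qed
qed

section \<open>Counting atoms in the polynomial ring\<close>

text \<open>A constant atom comes from an atom of the coefficient ring, which is prime there and
  hence also as a polynomial. Any atom of \<open>qs\<close> that it divides is its associate, so
  only constant atoms of \<open>qs\<close> are matched.\<close>

lemma length_constant_atoms_le:
  fixes ps qs :: "'a poly list"
  assumes "\<forall>p\<in>set ps. irreducible p" "\<forall>q\<in>set qs. irreducible q" "prod_list ps = prod_list qs"
  shows "length (filter (\<lambda>p. degree p = 0) ps) \<le> length (filter (\<lambda>q. degree q = 0) qs)"
proof -
  let ?cs = "filter (\<lambda>p. degree p = 0) ps"
  have "prime_elem p" if "p \<in> set ?cs" for p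
  proof -
    have "degree p = 0" using that by simp
    then obtain c where c: "p = [:c:]" by (rule degree_eq_zeroE)
    have "irreducible [:c:]" using that assms(1) c by simp
    then have "irreducible c" by (simp only: irreducible_const_poly_iff)
    then show ?thesis
      using irreducible_imp_prime_elem_coeff c by (simp add: prime_elem_const_poly_iff)
  qed
  moreover have "prod_list ?cs dvd prod_list ps"
    by (induction ps) (auto intro: mult_dvd_mono dvd_mult)
  ultimately have "length ?cs \<le> length (filter (\<lambda>q. \<exists>p\<in>set ?cs. p dvd q) qs)"
    using assms by (intro length_primes_le_if_prod_list_dvd) auto
  also have "filter (\<lambda>q. \<exists>p\<in>set ?cs. p dvd q) qs =
    filter (\<lambda>q. \<exists>p\<in>set ?cs. p dvd q) (filter (\<lambda>q. degree q = 0) qs)"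
  proof -
    have "degree q = 0" if q: "q \<in> set qs" and p: "p \<in> set ?cs" "p dvd q" for p q
    proof -
      obtain v where v: "q = p * v" using p(2) by (auto elim: dvdE)
      have "v dvd 1" using assms q p v irreducibleD[of q p v] by (auto simp: irreducible_def)
      then have "degree v = 0" by (auto simp: is_unit_poly_iff)
      then show ?thesis using p(1) v degree_mult_le[of p v] by simp
    qed
    then show ?thesis by (auto simp: intro!: filter_cong)
  qed
  also have "length \<dots> \<le> length (filter (\<lambda>q. degree q = 0) qs)" by (rule length_filter_le)
  finally show ?thesis .
qed

lemma length_atoms_poly_eq:
  fixes ps qs :: "'a poly list"
  assumes ps: "\<forall>p\<in>set ps. irreducible p" and qs: "\<forall>q\<in>set qs. irreducible q"
    and eq: "prod_list ps = prod_list qs"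
  shows "length ps = length qs"
proof -
  let ?const = "filter (\<lambda>p::'a poly. degree p = 0)"
  let ?nonconst = "\<lambda>xs. map fract_poly (filter (\<lambda>p::'a poly. degree p \<noteq> 0) xs)"
  have const: "length (?const ps) = length (?const qs)"
    using assms by (intro antisym length_constant_atoms_le) auto
  have nonconst_le: "length (?nonconst ps) \<le> length (?nonconst qs)"
    if ps: "\<forall>p\<in>set ps. irreducible p" and qs: "\<forall>q\<in>set qs. irreducible q"
      and eq: "prod_list ps = prod_list qs" for ps qs :: "'a poly list"
  proof -
    \<comment> \<open>Over the quotient field every constant atom is a nonzero constant, hence a
      unit, and is absorbed into \<open>u\<close>.\<close>
    have unit_times: "\<exists>u. u dvd 1 \<and> fract_poly (prod_list xs) = u * prod_list (?nonconst xs)"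
      if "\<forall>x\<in>set xs. irreducible x" for xs :: "'a poly list"
      using that
    proof (induction xs)
      case Nil
      then show ?case by (intro exI[of _ 1]) simp
    next
      case (Cons x xs)
      then obtain u where u: "u dvd 1" "fract_poly (prod_list xs) = u * prod_list (?nonconst xs)"
        by auto
      show ?case
      proof (cases "degree x = 0")
        case True
        then obtain c where c: "x = [:c:]" by (rule degree_eq_zeroE)
        with Cons.prems have "c \<noteq> 0" by auto
        then have "fract_poly x dvd 1" by (simp add: c map_poly_pCons is_unit_const_poly_iff dvd_field_iff)
        then show ?thesis
          using u True by (intro exI[of _ "fract_poly x * u"]) (auto simp: mult_ac)
      next
        case False
        then show ?thesis using u by (intro exI[of _ u]) (auto simp: mult_ac)
      qed
    qed
    obtain u where u: "u dvd 1" "fract_poly (prod_list ps) = u * prod_list (?nonconst ps)"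
      using unit_times[OF ps] by blast
    obtain v where v: "v dvd 1" "fract_poly (prod_list qs) = v * prod_list (?nonconst qs)"
      using unit_times[OF qs] by blast
    have "prod_list (?nonconst ps) dvd v * prod_list (?nonconst qs)"
      unfolding v(2)[symmetric] eq[symmetric] u(2) by simp
    then have "prod_list (?nonconst ps) dvd prod_list (?nonconst qs)"
      using v(1) by (simp add: dvd_mult_unit_iff')
    \<comment> \<open>The assumption on nonconstant irreducible polynomials carries these atoms to
      irreducibles over the field, which are prime there, so the divisibility count applies
      again.\<close>
    moreover have "irreducible x" if "x \<in> set (?nonconst ps) \<union> set (?nonconst qs)" for x
      using that ps qs irreducible_over_fract by auto
    ultimately have "length (?nonconst ps) \<le>
        length (filter (\<lambda>q. \<exists>p\<in>set (?nonconst ps). p dvd q) (?nonconst qs))"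
      by (intro length_primes_le_if_prod_list_dvd)
        (auto intro!: field_poly_irreducible_imp_prime)
    also have "\<dots> \<le> length (?nonconst qs)" by (rule length_filter_le)
    finally show ?thesis .
  qed
  have "length (?nonconst ps) = length (?nonconst qs)"
    using assms by (intro antisym nonconst_le) auto
  then show ?thesis
    using const sum_length_filter_compl[of "\<lambda>p. degree p = 0" ps]
      sum_length_filter_compl[of "\<lambda>p. degree p = 0" qs] by simp
qed

end

theorem mainTheorem3:
  assumes "\<exists>p::'a::idom. irreducible p"
    and "\<And>f :: 'a poly. degree f > 0 \<Longrightarrow> irreducible f \<Longrightarrow> irreducible (map_poly to_fract f :: 'a fract poly)"
  shows "elasticity TYPE('a) = 1 \<and> elasticity TYPE('a poly) = 1"
proof
  show "elasticity TYPE('a) = 1"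
    by (rule elasticity_eq_1_if_half_factorial, rule assms(1),
        rule length_eq_if_irreducible_imp_prime,
        rule irreducible_imp_prime_elem_coeff[OF assms(2)])
  show "elasticity TYPE('a poly) = 1"
  proof (rule elasticity_eq_1_if_half_factorial)
    show "\<exists>p::'a poly. irreducible p"
      using assms(1) irreducible_const_poly_iff by blast
  qed (rule length_atoms_poly_eq[OF assms(2)])
qed

end
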